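(* Let $G$ be a split metabelian group of odd order and, for $x,y\in G$, put $x\circ y = xy[y,x]^{1/2}$. Then $(G,\circ)$ is an automorphic loop.
   Context: A split metabelian group of odd order is a semidirect product $G=H\rtimes F$ of a normal abelian subgroup $H$ of (finite) odd order acted on by automorphisms by an abelian group $F$ of (finite) odd order. In a group $G$ of odd order, squaring is a bijection; $a^{1/2}$ denotes the unique $b\in G$ with $b^2=a$, and $[x,y]=x^{-1}y^{-1}xy$. It is known that $(G,\circ)$ is a commutative loop with neutral element $1$. A loop is a set $Q$ with a binary operation such that for all $a,b\in Q$ the equations $ax=b$ and $ya=b$ have unique solutions $x,y\in Q$, and there is $1\in Q$ with $1x=x1=x$ for all $x\in Q$. For $x\in Q$, the translations are $yL_x=xy$ and $yR_x=yx$ (maps act on the right). The multiplication group $\mathrm{Mlt}(Q)$ is the permutation group of $Q$ generated by all $L_x,R_x$, and the inner mapping group is $\mathrm{Inn}(Q)=\{\theta\in\mathrm{Mlt}(Q)\mid 1\theta=1\}$. A loop $Q$ is automorphic if every element of $\mathrm{Inn}(Q)$ is an automorphism of the loop $Q$. *)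

theory Defs
  imports "HOL-Algebra.Algebra"
begin

section \<open>Loops, multiplication groups and inner mappings\<close>

locale loop =
  fixes Q :: "('a, 'm) monoid_scheme" (structure)
  assumes mult_closed: "\<lbrakk>x \<in> carrier Q; y \<in> carrier Q\<rbrakk> \<Longrightarrow> x \<otimes> y \<in> carrier Q"
    and one_in_carrier: "\<one> \<in> carrier Q"
    and one_left: "x \<in> carrier Q \<Longrightarrow> \<one> \<otimes> x = x"
    and one_right: "x \<in> carrier Q \<Longrightarrow> x \<otimes> \<one> = x"
    and left_division: "\<lbrakk>a \<in> carrier Q; b \<in> carrier Q\<rbrakk> \<Longrightarrow> \<exists>!x. x \<in> carrier Q \<and> a \<otimes> x = b"
    and right_division: "\<lbrakk>a \<in> carrier Q; b \<in> carrier Q\<rbrakk> \<Longrightarrow> \<exists>!y. y \<in> carrier Q \<and> y \<otimes> a = b"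

definition left_translation :: "('a, 'm) monoid_scheme \<Rightarrow> 'a \<Rightarrow> 'a \<Rightarrow> 'a"
  where "left_translation Q x = (\<lambda>y\<in>carrier Q. x \<otimes>\<^bsub>Q\<^esub> y)"

definition right_translation :: "('a, 'm) monoid_scheme \<Rightarrow> 'a \<Rightarrow> 'a \<Rightarrow> 'a"
  where "right_translation Q x = (\<lambda>y\<in>carrier Q. y \<otimes>\<^bsub>Q\<^esub> x)"

text \<open>
  The group \<^term>\<open>BijGroup S\<close> composes maps acting on the left. For maps acting on the right
  one gets the opposite group, but a set of permutations generates the same subset in both.
\<close>

definition Mlt :: "('a, 'm) monoid_scheme \<Rightarrow> ('a \<Rightarrow> 'a) set"
  where "Mlt Q = generate (BijGroup (carrier Q))
    (left_translation Q ` carrier Q \<union> right_translation Q ` carrier Q)"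

definition Inn :: "('a, 'm) monoid_scheme \<Rightarrow> ('a \<Rightarrow> 'a) set"
  where "Inn Q = {\<theta> \<in> Mlt Q. \<theta> \<one>\<^bsub>Q\<^esub> = \<one>\<^bsub>Q\<^esub>}"

text \<open>
  The library's \<^term>\<open>auto Q\<close> is defined for arbitrary monoid records, without any
  associativity: it consists of the multiplicative bijections of the carrier.
\<close>

locale automorphic_loop = loop +
  assumes Inn_auto: "\<theta> \<in> Inn Q \<Longrightarrow> \<theta> \<in> auto Q"

section \<open>Split metabelian groups of odd order\<close>

text \<open>Internal semidirect product: \<open>F\<close> acts on \<open>H\<close> by conjugation inside \<open>G\<close>.\<close>

definition internal_semidirect ::
    "('a, 'm) monoid_scheme \<Rightarrow> 'a set \<Rightarrow> 'a set \<Rightarrow> bool"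
  where "internal_semidirect G H F \<longleftrightarrow>
    H \<lhd> G \<and> subgroup F G \<and> H \<inter> F = {\<one>\<^bsub>G\<^esub>} \<and> H <#>\<^bsub>G\<^esub> F = carrier G"

definition split_metabelian_odd_order :: "('a, 'm) monoid_scheme \<Rightarrow> bool"
  where "split_metabelian_odd_order G \<longleftrightarrow> group G \<and>
    (\<exists>H F. internal_semidirect G H F
      \<and> comm_group (G\<lparr>carrier := H\<rparr>) \<and> finite H \<and> odd (card H)
      \<and> comm_group (G\<lparr>carrier := F\<rparr>) \<and> finite F \<and> odd (card F))"

section \<open>The operation \<open>x \<circ> y = x y [y, x]\<^sup>1\<^sup>/\<^sup>2\<close>\<close>

text \<open>
  Well defined only if squaring is a bijection on the carrier, as it is in groups of odd order.
\<close>

definition square_root :: "('a, 'm) monoid_scheme \<Rightarrow> 'a \<Rightarrow> 'a"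
  where "square_root G a = (THE b. b \<in> carrier G \<and> b [^]\<^bsub>G\<^esub> (2::nat) = a)"

text \<open>Convention \<open>[x, y] = x\<inverse> y\<inverse> x y\<close>; the library's \<^const>\<open>derived\<close> uses \<open>x y x\<inverse> y\<inverse>\<close>.\<close>

definition commutator :: "('a, 'm) monoid_scheme \<Rightarrow> 'a \<Rightarrow> 'a \<Rightarrow> 'a"
  where "commutator G x y = inv\<^bsub>G\<^esub> x \<otimes>\<^bsub>G\<^esub> inv\<^bsub>G\<^esub> y \<otimes>\<^bsub>G\<^esub> x \<otimes>\<^bsub>G\<^esub> y"

definition circ_loop :: "('a, 'm) monoid_scheme \<Rightarrow> 'a monoid"
  where "circ_loop G =
    \<lparr>carrier = carrier G,
     monoid.mult = \<lambda>x y. x \<otimes>\<^bsub>G\<^esub> y \<otimes>\<^bsub>G\<^esub> square_root G (commutator G y x),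
     one = \<one>\<^bsub>G\<^esub>\<rparr>"

end

theory Submission
  imports Defs
begin

text \<open>
  Write \<open>H\<close> additively as an \<open>F\<close>-module and \<open>(h, f)\<close> for \<open>h f\<close>. Since \<open>x y\<close> and \<open>y x\<close> agree
  modulo \<open>H\<close>, the element \<open>x \<circ> y\<close> is the midpoint of \<open>x y\<close> and \<open>y x\<close> in their common coset, so
  \<open>(h, f) \<circ> (k, g) = (\<phi>\<^sub>g h + \<phi>\<^sub>f k, f g)\<close> with \<open>\<phi>\<^sub>f = (1 + f) / 2\<close>. The map \<open>\<phi>\<^sub>f\<close> is injective
  because \<open>f h = - h\<close> forces \<open>h = - h\<close>, the order of \<open>f\<close> being odd.
  Every element of the multiplication group then has the form
  \<open>(k, g) \<mapsto> (A k + u + g v, g p)\<close> with \<open>A\<close> an \<open>F\<close>-automorphism of \<open>H\<close>, as these maps form a group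
  containing the translations. Fixing the neutral element means \<open>p = 1\<close> and \<open>v = - u\<close>, and
  \<open>(k, g) \<mapsto> (A k + (1 - g) u, g)\<close> is an automorphism by the identity
  \<open>(1 + g) (1 - f) + (1 + f) (1 - g) = 2 (1 - f g)\<close>.
\<close>

section \<open>Unique decomposition and order of an internal semidirect product\<close>

text \<open>If the products agree, then \<open>inv k \<otimes> h = g \<otimes> inv f\<close> lies in
  both subgroups and is trivial.\<close>

lemma (in group) mult_eq_iff_of_Int_trivial:
  assumes "subgroup H G" "subgroup F G" "H \<inter> F = {\<one>}"
    and "h \<in> H" "k \<in> H" "f \<in> F" "g \<in> F"
  shows "h \<otimes> f = k \<otimes> g \<longleftrightarrow> h = k \<and> f = g"
proof
  note car = subgroup.mem_carrier[OF assms(1)] subgroup.mem_carrier[OF assms(2)]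
  assume eq: "h \<otimes> f = k \<otimes> g"
  then have "inv k \<otimes> h = g \<otimes> inv f"
    using assms car by (metis inv_closed inv_solve_left inv_solve_right m_assoc m_closed)
  then have "inv k \<otimes> h \<in> H \<inter> F"
    using assms by (metis IntI subgroup.m_closed subgroup.m_inv_closed)
  then have "inv k \<otimes> h = \<one>"
    using assms(3) by blast
  then have "h = k"
    using assms car by (metis inv_closed inv_equality inv_inv)
  then show "h = k \<and> f = g"
    using eq assms car by simp
qed simp

lemma (in group) order_internal_semidirect:
  assumes "internal_semidirect G H F"
  shows "order G = card H * card F"
proof -
  have sub: "subgroup H G" "subgroup F G" "H \<inter> F = {\<one>}" and prod: "H <#> F = carrier G"
    using assms by (auto simp: internal_semidirect_def normal_imp_subgroup)
  have "inj_on (\<lambda>(h, f). h \<otimes> f) (H \<times> F)"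
    by (auto simp: inj_on_def mult_eq_iff_of_Int_trivial[OF sub])
  moreover have "(\<lambda>(h, f). h \<otimes> f) ` (H \<times> F) = carrier G"
    unfolding prod[symmetric] set_mult_def by auto
  ultimately show ?thesis
    unfolding order_def by (metis card_cartesian_product card_image)
qed

text \<open>The witness \<open>m\<close> of odd order is a parameter because halving will be the
  power with exponent \<open>Suc m\<close>.\<close>

locale split_metabelian_odd = group G for G :: "('a, 'm) monoid_scheme" (structure) +
  fixes H F :: "'a set" and m :: nat
  assumes semidirect: "internal_semidirect G H F"
    and H_commute: "\<lbrakk>x \<in> H; y \<in> H\<rbrakk> \<Longrightarrow> x \<otimes> y = y \<otimes> x"
    and F_commute: "\<lbrakk>x \<in> F; y \<in> F\<rbrakk> \<Longrightarrow> x \<otimes> y = y \<otimes> x"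
    and finite_G: "finite (carrier G)"
    and order_eq: "order G = 2 * m + 1"
begin

lemma H_normal: "H \<lhd> G" and F_subgroup: "subgroup F G" and H_Int_F: "H \<inter> F = {\<one>}"
  and H_mult_F: "H <#> F = carrier G"
  using semidirect by (auto simp: internal_semidirect_def)

lemma H_subgroup: "subgroup H G"
  using H_normal by (rule normal_imp_subgroup)

lemma HF_closed [simp, intro]:
  "x \<in> H \<Longrightarrow> x \<in> carrier G" "x \<in> F \<Longrightarrow> x \<in> carrier G"
  "\<lbrakk>x \<in> H; y \<in> H\<rbrakk> \<Longrightarrow> x \<otimes> y \<in> H" "\<lbrakk>x \<in> F; y \<in> F\<rbrakk> \<Longrightarrow> x \<otimes> y \<in> F"
  "x \<in> H \<Longrightarrow> inv x \<in> H" "x \<in> F \<Longrightarrow> inv x \<in> F" "\<one> \<in> H" "\<one> \<in> F"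
  using H_subgroup F_subgroup
  by (auto simp: subgroup.mem_carrier subgroup.m_closed subgroup.m_inv_closed subgroup.one_closed)

lemma H_left_commute: "\<lbrakk>x \<in> H; y \<in> H; z \<in> H\<rbrakk> \<Longrightarrow> x \<otimes> (y \<otimes> z) = y \<otimes> (x \<otimes> z)"
  by (metis H_commute HF_closed(1) m_assoc)

lemma H_assoc: "\<lbrakk>x \<in> H; y \<in> H; z \<in> H\<rbrakk> \<Longrightarrow> x \<otimes> y \<otimes> z = x \<otimes> (y \<otimes> z)"
  by (simp add: m_assoc)

lemmas H_ac = H_assoc H_commute H_left_commute

lemma mult_inv_cancel:
  "\<lbrakk>x \<in> carrier G; y \<in> carrier G\<rbrakk> \<Longrightarrow> x \<otimes> (inv x \<otimes> y) = y"
  by (simp flip: m_assoc)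

lemma decomposition:
  assumes "x \<in> carrier G"
  obtains h f where "h \<in> H" "f \<in> F" "x = h \<otimes> f"
  using assms H_mult_F unfolding set_mult_def by blast

lemma decomposition_unique:
  "\<lbrakk>h \<in> H; k \<in> H; f \<in> F; g \<in> F\<rbrakk> \<Longrightarrow> h \<otimes> f = k \<otimes> g \<longleftrightarrow> h = k \<and> f = g"
  using H_subgroup F_subgroup H_Int_F by (rule mult_eq_iff_of_Int_trivial)

section \<open>The conjugation action\<close>

text \<open>With the inverse on the right, \<open>g \<otimes> h = act g h \<otimes> g\<close> and
  \<open>act\<close> is a left action.\<close>

definition act :: "'a \<Rightarrow> 'a \<Rightarrow> 'a"
  where "act g h = g \<otimes> h \<otimes> inv g"

lemma act_closed [simp, intro]: "\<lbrakk>g \<in> carrier G; h \<in> H\<rbrakk> \<Longrightarrow> act g h \<in> H"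
  unfolding act_def using H_normal by (simp add: normal.inv_op_closed2)

lemma act_mult:
  "\<lbrakk>g \<in> carrier G; h \<in> carrier G; k \<in> carrier G\<rbrakk> \<Longrightarrow> act g (h \<otimes> k) = act g h \<otimes> act g k"
  unfolding act_def by (simp add: m_assoc inv_solve_left)

lemma act_act:
  "\<lbrakk>g \<in> carrier G; f \<in> carrier G; h \<in> carrier G\<rbrakk> \<Longrightarrow> act g (act f h) = act (g \<otimes> f) h"
  unfolding act_def by (simp add: m_assoc inv_mult_group)

lemma act_one [simp]: "h \<in> carrier G \<Longrightarrow> act \<one> h = h"
  unfolding act_def by simp

lemma act_arg_one [simp]: "g \<in> carrier G \<Longrightarrow> act g \<one> = \<one>"
  unfolding act_def by simp

lemma act_inv: "\<lbrakk>g \<in> carrier G; h \<in> carrier G\<rbrakk> \<Longrightarrow> act g (inv h) = inv (act g h)"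
  unfolding act_def by (simp add: m_assoc inv_mult_group)

lemma act_nat_pow:
  "\<lbrakk>g \<in> carrier G; h \<in> carrier G\<rbrakk> \<Longrightarrow> act g (h [^] (n::nat)) = act g h [^] n"
  by (induction n) (auto simp: act_mult)

lemma act_commute: "\<lbrakk>g \<in> F; f \<in> F; h \<in> H\<rbrakk> \<Longrightarrow> act g (act f h) = act f (act g h)"
  by (simp add: act_act F_commute)

lemma mult_semidirect:
  "\<lbrakk>h \<in> H; f \<in> F; k \<in> H; g \<in> F\<rbrakk> \<Longrightarrow> (h \<otimes> f) \<otimes> (k \<otimes> g) = h \<otimes> act f k \<otimes> (f \<otimes> g)"
  unfolding act_def by (simp add: m_assoc inv_solve_left)

section \<open>Halving, and square roots in H\<close>

text \<open>As \<open>order G = 2 * m + 1\<close>, doubling the exponent \<open>Suc m\<close> gives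
  the order plus one, so this power inverts squaring. Being a power, it commutes with conjugation
  and inversion.\<close>

definition half :: "'a \<Rightarrow> 'a"
  where "half h = h [^] Suc m"

lemma half_closed [simp, intro]: "h \<in> carrier G \<Longrightarrow> half h \<in> carrier G"
  unfolding half_def by (rule nat_pow_closed)

lemma H_half_closed [simp, intro]: "h \<in> H \<Longrightarrow> half h \<in> H"
proof -
  assume h: "h \<in> H"
  have "h [^] n \<in> H" for n :: nat
    by (induction n) (use h in auto)
  then show ?thesis unfolding half_def .
qed

lemma half_square: "h \<in> carrier G \<Longrightarrow> half (h \<otimes> h) = h"
proof -
  assume h: "h \<in> carrier G"
  have "half (h \<otimes> h) = h [^] (Suc m + Suc m)"
    unfolding half_def using h by (simp only: pow_mult_distrib nat_pow_mult)
  also have "Suc m + Suc m = Suc (2 * m + 1)" by simp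
  also have "h [^] Suc (2 * m + 1) = h [^] (2 * m + 1) \<otimes> h" by (rule nat_pow_Suc)
  also have "\<dots> = h"
    using h pow_order_eq_1[of h] order_eq by simp
  finally show ?thesis .
qed

lemma half_mult: "\<lbrakk>h \<in> H; k \<in> H\<rbrakk> \<Longrightarrow> half (h \<otimes> k) = half h \<otimes> half k"
  unfolding half_def by (rule pow_mult_distrib) (auto simp: H_commute)

lemma half_mult_half: "h \<in> H \<Longrightarrow> half h \<otimes> half h = h"
  by (metis HF_closed(1) half_mult half_square)

lemma half_inv: "h \<in> carrier G \<Longrightarrow> half (inv h) = inv (half h)"
  unfolding half_def by (rule nat_pow_inv)

lemma half_act: "\<lbrakk>g \<in> carrier G; h \<in> carrier G\<rbrakk> \<Longrightarrow> half (act g h) = act g (half h)"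
  unfolding half_def by (simp only: act_nat_pow)

text \<open>Uniqueness comes from \<open>half_square\<close>, which holds on all of \<open>G\<close>
  and so also excludes roots outside \<open>H\<close>.\<close>

lemma square_root_eq_half:
  assumes "h \<in> H"
  shows "square_root G h = half h"
  unfolding square_root_def
proof (rule the_equality)
  show "half h \<in> carrier G \<and> half h [^] (2::nat) = h"
    using assms by (simp add: numeral_2_eq_2 half_mult_half)
  show "b = half h" if "b \<in> carrier G \<and> b [^] (2::nat) = h" for b
    using that half_square[of b] by (auto simp: numeral_2_eq_2)
qed

section \<open>The maps (1 + f) / 2 on H\<close>

definition mean :: "'a \<Rightarrow> 'a \<Rightarrow> 'a"
  where "mean f h = half (h \<otimes> act f h)"

lemma mean_closed [simp, intro]: "\<lbrakk>f \<in> F; h \<in> H\<rbrakk> \<Longrightarrow> mean f h \<in> H"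
  unfolding mean_def by auto

lemma mean_eq: "\<lbrakk>f \<in> F; h \<in> H\<rbrakk> \<Longrightarrow> mean f h = half h \<otimes> act f (half h)"
  unfolding mean_def by (simp add: half_mult half_act)

lemma mean_mult: "\<lbrakk>f \<in> F; h \<in> H; k \<in> H\<rbrakk> \<Longrightarrow> mean f (h \<otimes> k) = mean f h \<otimes> mean f k"
  by (simp add: mean_eq half_mult act_mult H_ac)

lemma mean_one [simp]: "h \<in> H \<Longrightarrow> mean \<one> h = h"
  unfolding mean_def by (simp add: half_square)

lemma mean_arg_one [simp]: "f \<in> F \<Longrightarrow> mean f \<one> = \<one>"
  unfolding mean_def by (simp add: half_def)

lemma mean_act: "\<lbrakk>f \<in> F; g \<in> F; h \<in> H\<rbrakk> \<Longrightarrow> mean f (act g h) = act g (mean f h)"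
  by (simp add: mean_eq act_mult half_act act_commute)

text \<open>Here \<open>f\<close> inverts \<open>h\<close>, so even powers of \<open>f\<close> fix
  \<open>h\<close>, while the odd power \<open>f [^] (2 * m + 1)\<close>, which is
  \<open>\<one>\<close>, inverts it. Hence \<open>h \<otimes> h = \<one>\<close>, and halving gives
  \<open>h = \<one>\<close>.\<close>

lemma fixed_point_free:
  assumes "f \<in> F" "h \<in> H" "h \<otimes> act f h = \<one>"
  shows "h = \<one>"
proof -
  have act_f: "act f h = inv h"
    using assms by (metis HF_closed(1,2) act_closed inv_equality inv_inv)
  have even: "act (f [^] (2 * n)) h = h" for n :: nat
  proof (induction n)
    case (Suc n)
    have "act (f [^] (2 * Suc n)) h = act (f [^] (2 * n)) (act f (act f h))"
      using assms by (simp add: act_act m_assoc)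
    also have "act f (act f h) = h"
      using assms act_f by (simp add: act_inv)
    finally show ?case using Suc by simp
  qed (use assms in simp)
  have "h = act (f [^] (2 * m + 1)) h"
    using assms pow_order_eq_1[of f] order_eq by simp
  also have "\<dots> = act (f [^] (2 * m)) (act f h)"
    using assms by (simp add: act_act)
  also have "\<dots> = inv h"
    using assms even act_f by (simp add: act_inv)
  finally have "h \<otimes> h = \<one>"
    using assms by (metis HF_closed(1) r_inv)
  then show ?thesis
    using assms half_square[of h] by (simp add: half_def)
qed

text \<open>Additivity reduces injectivity to a trivial kernel, which is
  \<open>fixed_point_free\<close>; surjectivity follows since \<open>H\<close> is finite.\<close>

lemma mean_bij: "f \<in> F \<Longrightarrow> bij_betw (mean f) H H"
proof -
  assume f: "f \<in> F"
  have "inj_on (mean f) H"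
  proof (rule inj_onI)
    fix h k assume hk: "h \<in> H" "k \<in> H" "mean f h = mean f k"
    have "mean f (h \<otimes> inv k) = mean f k \<otimes> mean f (inv k)"
      using f hk by (simp add: mean_mult)
    also have "\<dots> = \<one>"
      using f hk by (simp flip: mean_mult)
    finally have "half (h \<otimes> inv k \<otimes> act f (h \<otimes> inv k)) = \<one>"
      by (simp add: mean_def)
    \<comment> \<open>Squaring both sides removes the half.\<close>
    then have "h \<otimes> inv k \<otimes> act f (h \<otimes> inv k) = \<one>"
      using f hk half_mult_half[of "h \<otimes> inv k \<otimes> act f (h \<otimes> inv k)"] by simp
    then have "h \<otimes> inv k = \<one>"
      using f hk fixed_point_free[of f "h \<otimes> inv k"] by simp
    then show "h = k" using hk
      by (metis HF_closed(1) inv_closed inv_equality inv_inv)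
  qed
  moreover have "finite H"
    using finite_G by (rule rev_finite_subset) auto
  moreover have "mean f ` H \<subseteq> H"
    using f by auto
  ultimately show ?thesis
    by (simp add: bij_betw_def endo_inj_surj)
qed

section \<open>The loop operation in semidirect coordinates\<close>

abbreviation circ (infixl \<open>\<circ>\<circ>\<close> 70)
  where "x \<circ>\<circ> y \<equiv> x \<otimes>\<^bsub>circ_loop G\<^esub> y"

lemma circ_loop_simps [simp]:
  "carrier (circ_loop G) = carrier G" "\<one>\<^bsub>circ_loop G\<^esub> = \<one>"
  by (simp_all add: circ_loop_def)

lemma circ_semidirect:
  assumes "h \<in> H" "f \<in> F" "k \<in> H" "g \<in> F"
  shows "(h \<otimes> f) \<circ>\<circ> (k \<otimes> g) = mean g h \<otimes> mean f k \<otimes> (f \<otimes> g)"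
proof -
  \<comment> \<open>\<open>r\<close> and \<open>s\<close> are the H-parts of the two products, and
    \<open>c\<close> is their F-part, common to both because \<open>F\<close> is abelian.\<close>
  define r s c where "r = h \<otimes> act f k" and "s = k \<otimes> act g h" and "c = f \<otimes> g"
  have [simp]: "r \<in> H" "s \<in> H" "c \<in> F"
    unfolding r_def s_def c_def using assms by auto
  have xy: "(h \<otimes> f) \<otimes> (k \<otimes> g) = r \<otimes> c" and yx: "(k \<otimes> g) \<otimes> (h \<otimes> f) = s \<otimes> c"
    unfolding r_def s_def c_def using assms by (simp_all add: mult_semidirect F_commute)
  \<comment> \<open>[y, x] is the inverse of x y times y x. The common \<open>c\<close> turns this
    into a conjugate of \<open>inv r \<otimes> s\<close>, an element of \<open>H\<close>, where the
    root is \<open>half\<close>.\<close>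
  have "commutator G (k \<otimes> g) (h \<otimes> f) = inv ((h \<otimes> f) \<otimes> (k \<otimes> g)) \<otimes> ((k \<otimes> g) \<otimes> (h \<otimes> f))"
    unfolding commutator_def using assms
    by (simp only: inv_mult_group m_assoc m_closed HF_closed inv_closed)
  also have "\<dots> = act (inv c) (inv r \<otimes> s)"
    unfolding xy yx act_def by (simp add: inv_mult_group m_assoc)
  finally have "square_root G (commutator G (k \<otimes> g) (h \<otimes> f)) = act (inv c) (half (inv r \<otimes> s))"
    by (simp add: square_root_eq_half half_act)
  then have "(h \<otimes> f) \<circ>\<circ> (k \<otimes> g) = r \<otimes> c \<otimes> act (inv c) (half (inv r \<otimes> s))"
    by (simp add: circ_loop_def xy)
  also have "\<dots> = r \<otimes> half (inv r \<otimes> s) \<otimes> c"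
    unfolding act_def by (simp add: m_assoc mult_inv_cancel)
  \<comment> \<open>Additively, r + (s - r) / 2 = (r + s) / 2.\<close>
  also have "r \<otimes> half (inv r \<otimes> s) = half (r \<otimes> r) \<otimes> half (inv r \<otimes> s)"
    by (simp add: half_square)
  also have "\<dots> = half (r \<otimes> (r \<otimes> (inv r \<otimes> s)))"
    by (simp flip: half_mult add: H_assoc)
  also have "r \<otimes> (inv r \<otimes> s) = s"
    by (simp flip: m_assoc)
  also have "half (r \<otimes> s) = half ((h \<otimes> act g h) \<otimes> (k \<otimes> act f k))"
    unfolding r_def s_def using assms by (simp add: H_ac)
  also have "\<dots> = mean g h \<otimes> mean f k"
    unfolding mean_def using assms by (simp add: half_mult)
  finally show ?thesis unfolding c_def .
qed

lemma circ_commute: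
  assumes "x \<in> carrier G" "y \<in> carrier G"
  shows "x \<circ>\<circ> y = y \<circ>\<circ> x"
proof -
  obtain h f k g where "h \<in> H" "f \<in> F" "x = h \<otimes> f" "k \<in> H" "g \<in> F" "y = k \<otimes> g"
    using assms by (elim decomposition) blast
  then show ?thesis
    by (simp add: circ_semidirect H_commute F_commute)
qed

lemma circ_closed: "\<lbrakk>x \<in> carrier G; y \<in> carrier G\<rbrakk> \<Longrightarrow> x \<circ>\<circ> y \<in> carrier G"
  by (elim decomposition) (auto simp: circ_semidirect)

lemma circ_one: "x \<in> carrier G \<Longrightarrow> x \<circ>\<circ> \<one> = x"
proof (elim decomposition)
  fix h f assume "h \<in> H" "f \<in> F" "x = h \<otimes> f"
  then show "x \<circ>\<circ> \<one> = x"
    using circ_semidirect[of h f \<one> \<one>] by simp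
qed

section \<open>Module automorphisms of H\<close>

text \<open>All conditions are on \<open>H\<close> alone, so maps such as
  \<open>inv_into H A\<close> qualify whatever their values elsewhere.\<close>

definition F_automorphism :: "('a \<Rightarrow> 'a) \<Rightarrow> bool"
  where "F_automorphism A \<longleftrightarrow> bij_betw A H H \<and>
    (\<forall>h\<in>H. \<forall>k\<in>H. A (h \<otimes> k) = A h \<otimes> A k) \<and> (\<forall>g\<in>F. \<forall>h\<in>H. A (act g h) = act g (A h))"

lemma F_automorphismD:
  assumes "F_automorphism A"
  shows "bij_betw A H H" "h \<in> H \<Longrightarrow> A h \<in> H"
    "\<lbrakk>h \<in> H; k \<in> H\<rbrakk> \<Longrightarrow> A (h \<otimes> k) = A h \<otimes> A k"
    "\<lbrakk>g \<in> F; h \<in> H\<rbrakk> \<Longrightarrow> A (act g h) = act g (A h)"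
  using assms by (auto simp: F_automorphism_def bij_betw_apply)

lemma F_automorphism_one:
  assumes "F_automorphism A"
  shows "A \<one> = \<one>"
proof -
  have "A \<one> \<otimes> A \<one> = A \<one>"
    using F_automorphismD(3)[OF assms, of \<one> \<one>] by simp
  then show ?thesis
    using F_automorphismD(2)[OF assms, of \<one>] by simp
qed

lemma F_automorphism_half:
  assumes "F_automorphism A" "h \<in> H"
  shows "A (half h) = half (A h)"
proof -
  have "A h = A (half h) \<otimes> A (half h)"
    using assms F_automorphismD(3)[OF assms(1), of "half h" "half h"]
    by (simp add: half_mult_half)
  then show ?thesis
    using assms by (metis F_automorphismD(2) H_half_closed HF_closed(1) half_square)
qed

text \<open>\<open>mean\<close> is built from multiplication, action and halving, all of which
  \<open>A\<close> respects. This lets the linear part of an inner mapping pass through the loop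
  operation.\<close>

lemma F_automorphism_mean:
  assumes "F_automorphism A" "f \<in> F" "h \<in> H"
  shows "A (mean f h) = mean f (A h)"
  unfolding mean_def using assms by (simp add: F_automorphismD F_automorphism_half)

lemma F_automorphism_id: "F_automorphism (\<lambda>h. h)"
  by (simp add: F_automorphism_def bij_betw_def)

lemma F_automorphism_mean_map: "f \<in> F \<Longrightarrow> F_automorphism (mean f)"
  by (simp add: F_automorphism_def mean_bij mean_mult mean_act)

lemma F_automorphism_compose:
  "\<lbrakk>F_automorphism A; F_automorphism B\<rbrakk> \<Longrightarrow> F_automorphism (\<lambda>h. A (B h))"
  using bij_betw_trans[of B H H A H]
  by (auto simp: F_automorphism_def o_def bij_betw_apply)

lemma F_automorphism_inv_into:
  assumes A: "F_automorphism A"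
  shows "F_automorphism (inv_into H A)"
proof -
  note bij = F_automorphismD(1)[OF A]
  have B: "inv_into H A h \<in> H" if "h \<in> H" for h
    using that bij by (metis bij_betw_apply bij_betw_inv_into)
  have AB: "A (inv_into H A h) = h" if "h \<in> H" for h
    using that bij by (metis bij_betw_inv_into_right)
  have eq: "inv_into H A h = k" if "k \<in> H" "A k = h" for h k
    using that bij by (metis bij_betw_inv_into_left)
  show ?thesis
    unfolding F_automorphism_def
    by (auto intro!: bij_betw_inv_into[OF bij] eq simp: B AB F_automorphismD[OF A])
qed

section \<open>The group of affine maps\<close>

text \<open>The translation part needs a term depending on \<open>g\<close>: left translation by
  \<open>h \<otimes> f\<close> contributes \<open>mean g h\<close>, that is, h / 2 + g h /
  2.\<close>

definition affine_with :: "('a \<Rightarrow> 'a) \<Rightarrow> 'a \<Rightarrow> 'a \<Rightarrow> 'a \<Rightarrow> ('a \<Rightarrow> 'a) \<Rightarrow> bool"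
  where "affine_with A u v p \<theta> \<longleftrightarrow> F_automorphism A \<and> u \<in> H \<and> v \<in> H \<and> p \<in> F \<and>
    (\<forall>k\<in>H. \<forall>g\<in>F. \<theta> (k \<otimes> g) = A k \<otimes> (u \<otimes> act g v) \<otimes> (g \<otimes> p))"

lemma affine_withD:
  assumes "affine_with A u v p \<theta>"
  shows "F_automorphism A" "u \<in> H" "v \<in> H" "p \<in> F"
    "\<lbrakk>k \<in> H; g \<in> F\<rbrakk> \<Longrightarrow> \<theta> (k \<otimes> g) = A k \<otimes> (u \<otimes> act g v) \<otimes> (g \<otimes> p)"
  using assms by (auto simp: affine_with_def)

text \<open>The F-part of the image determines \<open>g\<close>; the translation parts then agree,
  and \<open>A\<close> is injective. Finiteness gives surjectivity.\<close>

lemma affine_bij: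
  assumes "affine_with A u v p \<theta>"
  shows "bij_betw \<theta> (carrier G) (carrier G)"
proof -
  note D = affine_withD[OF assms] and AD = F_automorphismD[OF affine_withD(1)[OF assms]]
  have "inj_on \<theta> (carrier G)"
  proof (rule inj_onI)
    fix x y assume xy: "x \<in> carrier G" "y \<in> carrier G" "\<theta> x = \<theta> y"
    obtain h f k g where *: "h \<in> H" "f \<in> F" "x = h \<otimes> f" "k \<in> H" "g \<in> F" "y = k \<otimes> g"
      using xy by (elim decomposition) blast
    have "A h \<otimes> (u \<otimes> act f v) \<otimes> (f \<otimes> p) = A k \<otimes> (u \<otimes> act g v) \<otimes> (g \<otimes> p)"
      using xy(3) * by (simp only: D(5))
    then have eq: "A h \<otimes> (u \<otimes> act f v) = A k \<otimes> (u \<otimes> act g v)" and "f \<otimes> p = g \<otimes> p"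
      using *(1,2,4,5) D(2-4) AD(2) by (simp_all only: decomposition_unique HF_closed act_closed)
    then have "f = g"
      using *(2,5) D(4) by simp
    with eq have "A h \<otimes> (u \<otimes> act g v) = A k \<otimes> (u \<otimes> act g v)"
      by simp
    then have "A h = A k"
      using * D(2,3) AD(2)[of h] AD(2)[of k] by (meson HF_closed act_closed r_cancel)
    then show "x = y"
      using AD(1) * \<open>f = g\<close> by (metis bij_betw_inv_into_left)
  qed
  moreover have "\<theta> ` carrier G \<subseteq> carrier G"
  proof
    fix y assume "y \<in> \<theta> ` carrier G"
    then obtain h f where *: "h \<in> H" "f \<in> F" "y = \<theta> (h \<otimes> f)"
      by (metis decomposition imageE)
    then show "y \<in> carrier G"
      using D(2-4) AD(2) by (simp add: D(5))
  qed
  ultimately show ?thesis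
    using finite_G by (simp add: bij_betw_def endo_inj_surj)
qed

text \<open>Extensionality matches the elements of \<open>BijGroup (carrier G)\<close>.\<close>

definition affine_maps :: "('a \<Rightarrow> 'a) set"
  where "affine_maps = {\<theta> \<in> extensional (carrier G). \<exists>A u v p. affine_with A u v p \<theta>}"

lemma affine_maps_Bij: "\<theta> \<in> affine_maps \<Longrightarrow> \<theta> \<in> Bij (carrier G)"
  unfolding affine_maps_def Bij_def using affine_bij by blast

lemma affine_compose:
  assumes "\<theta> \<in> affine_maps" "\<eta> \<in> affine_maps"
  shows "compose (carrier G) \<theta> \<eta> \<in> affine_maps"
proof -
  obtain A u v p B u' v' p' where
    1: "affine_with A u v p \<theta>" and 2: "affine_with B u' v' p' \<eta>"
    using assms unfolding affine_maps_def by blast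
  note D = affine_withD[OF 1] affine_withD[OF 2]
  note AD = F_automorphismD[OF D(1)] and BD = F_automorphismD[OF D(6)]
  \<comment> \<open>Expanding A (B k + u' + g v') + u + g p' v and collecting the terms under g
    gives these parameters.\<close>
  have "affine_with (\<lambda>h. A (B h)) (A u' \<otimes> u) (A v' \<otimes> act p' v) (p' \<otimes> p)
      (compose (carrier G) \<theta> \<eta>)"
    unfolding affine_with_def
  proof (intro conjI ballI)
    fix k g assume kg: "k \<in> H" "g \<in> F"
    note cl = kg D(2-4,7-9) AD(2) BD(2)
    have "compose (carrier G) \<theta> \<eta> (k \<otimes> g) = \<theta> (B k \<otimes> (u' \<otimes> act g v') \<otimes> (g \<otimes> p'))"
      using cl by (simp add: compose_def D(10))
    also have "\<dots> = A (B k \<otimes> (u' \<otimes> act g v')) \<otimes> (u \<otimes> act (g \<otimes> p') v) \<otimes> (g \<otimes> p' \<otimes> p)"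
      using cl by (subst D(5)) auto
    also have "A (B k \<otimes> (u' \<otimes> act g v')) \<otimes> (u \<otimes> act (g \<otimes> p') v)
        = A (B k) \<otimes> (A u' \<otimes> u \<otimes> act g (A v' \<otimes> act p' v))"
      using cl by (simp add: AD(3,4) act_mult act_act H_ac)
    also have "g \<otimes> p' \<otimes> p = g \<otimes> (p' \<otimes> p)"
      using cl by (simp add: m_assoc)
    finally show "compose (carrier G) \<theta> \<eta> (k \<otimes> g) = A (B k)
        \<otimes> (A u' \<otimes> u \<otimes> act g (A v' \<otimes> act p' v)) \<otimes> (g \<otimes> (p' \<otimes> p))" .
  qed (use D AD BD F_automorphism_compose in auto)
  then show ?thesis
    unfolding affine_maps_def by auto
qed

lemma affine_inverse:
  assumes "\<theta> \<in> affine_maps"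
  shows "restrict (inv_into (carrier G) \<theta>) (carrier G) \<in> affine_maps"
proof -
  obtain A u v p where 1: "affine_with A u v p \<theta>"
    using assms unfolding affine_maps_def by blast
  note D = affine_withD[OF 1]
  note AD = F_automorphismD[OF D(1)]
  define B where "B = inv_into H A"
  have B: "F_automorphism B"
    unfolding B_def using D(1) by (rule F_automorphism_inv_into)
  note BD = F_automorphismD[OF B]
  have AB: "A (B h) = h" if "h \<in> H" for h
    unfolding B_def using that AD(1) by (metis bij_betw_inv_into_right)
  \<comment> \<open>Solving A x + u + y v = k and y p = g gives y = g p^-1 and x = B (k - u - g p^-1
    v).\<close>
  have "affine_with B (B (inv u)) (B (act (inv p) (inv v))) (inv p)
      (restrict (inv_into (carrier G) \<theta>) (carrier G))"
    unfolding affine_with_def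
  proof (intro conjI ballI)
    fix k g assume kg: "k \<in> H" "g \<in> F"
    note cl = kg D(2-4) BD(2)
    let ?x = "B k \<otimes> (B (inv u) \<otimes> act g (B (act (inv p) (inv v))))"
    have A: "A ?x = k \<otimes> (inv u \<otimes> act g (act (inv p) (inv v)))"
      using cl by (simp add: AD(3,4) AB)
    have "\<theta> (?x \<otimes> (g \<otimes> inv p)) = A ?x \<otimes> (u \<otimes> act (g \<otimes> inv p) v) \<otimes> (g \<otimes> inv p \<otimes> p)"
      using cl by (subst D(5)) auto
    also have "A ?x \<otimes> (u \<otimes> act (g \<otimes> inv p) v)
        = k \<otimes> ((u \<otimes> inv u) \<otimes> (act (g \<otimes> inv p) v \<otimes> inv (act (g \<otimes> inv p) v)))"
      unfolding A using cl by (simp add: act_act act_inv H_ac del: r_inv)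
    also have "\<dots> = k"
      using cl by simp
    also have "g \<otimes> inv p \<otimes> p = g"
      using cl by (simp add: m_assoc)
    finally have "\<theta> (?x \<otimes> (g \<otimes> inv p)) = k \<otimes> g" .
    then have "inv_into (carrier G) \<theta> (k \<otimes> g) = ?x \<otimes> (g \<otimes> inv p)"
      using affine_bij[OF 1] cl by (intro inv_into_f_eq) (auto simp: bij_betw_def)
    then show "restrict (inv_into (carrier G) \<theta>) (carrier G) (k \<otimes> g) = ?x \<otimes> (g \<otimes> inv p)"
      using cl by simp
  qed (use D BD B in auto)
  then show ?thesis
    unfolding affine_maps_def by auto
qed

lemma affine_id: "(\<lambda>x\<in>carrier G. x) \<in> affine_maps"
proof -
  have "affine_with (\<lambda>h. h) \<one> \<one> \<one> (\<lambda>x\<in>carrier G. x)"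
    by (simp add: affine_with_def F_automorphism_id)
  then show ?thesis
    unfolding affine_maps_def by auto
qed

lemma affine_maps_subgroup: "subgroup affine_maps (BijGroup (carrier G))"
proof (rule group.subgroupI[OF group_BijGroup])
  show "affine_maps \<subseteq> carrier (BijGroup (carrier G))"
    using affine_maps_Bij by (auto simp: BijGroup_def)
  show "affine_maps \<noteq> {}"
    using affine_id by blast
  show "inv\<^bsub>BijGroup (carrier G)\<^esub> \<theta> \<in> affine_maps" if "\<theta> \<in> affine_maps" for \<theta>
    using that by (simp add: inv_BijGroup affine_maps_Bij affine_inverse)
  show "\<theta> \<otimes>\<^bsub>BijGroup (carrier G)\<^esub> \<eta> \<in> affine_maps"
    if "\<theta> \<in> affine_maps" "\<eta> \<in> affine_maps" for \<theta> \<eta>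
    using that by (simp add: BijGroup_def affine_maps_Bij affine_compose)
qed

section \<open>Translations and the multiplication group\<close>

lemma left_translation_affine:
  assumes "x \<in> carrier G"
  shows "left_translation (circ_loop G) x \<in> affine_maps"
proof -
  obtain h f where x: "h \<in> H" "f \<in> F" "x = h \<otimes> f"
    using assms by (rule decomposition)
  \<comment> \<open>Both translation parameters are \<open>half h\<close>, since
    \<open>mean g h = half h \<otimes> act g (half h)\<close>.\<close>
  have "affine_with (mean f) (half h) (half h) f (left_translation (circ_loop G) x)"
    unfolding affine_with_def
  proof (intro conjI ballI)
    fix k g assume kg: "k \<in> H" "g \<in> F"
    have "left_translation (circ_loop G) x (k \<otimes> g) = mean g h \<otimes> mean f k \<otimes> (f \<otimes> g)"
      using x kg by (simp add: left_translation_def circ_semidirect)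
    also have "mean g h \<otimes> mean f k = mean f k \<otimes> (half h \<otimes> act g (half h))"
      using x kg by (simp add: mean_eq[of g h] H_commute)
    also have "f \<otimes> g = g \<otimes> f"
      using x kg by (simp add: F_commute)
    finally show "left_translation (circ_loop G) x (k \<otimes> g)
      = mean f k \<otimes> (half h \<otimes> act g (half h)) \<otimes> (g \<otimes> f)" .
  qed (use x F_automorphism_mean_map in auto)
  then show ?thesis
    unfolding affine_maps_def by (auto simp: left_translation_def)
qed

lemma right_translation_eq_left:
  "x \<in> carrier G \<Longrightarrow> right_translation (circ_loop G) x = left_translation (circ_loop G) x"
  by (auto simp: right_translation_def left_translation_def circ_commute intro!: restrict_ext)

text \<open>The affine maps form a subgroup containing all generators; right translations equal left
  ones by commutativity.\<close>

lemma Mlt_affine: "Mlt (circ_loop G) \<subseteq> affine_maps"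
  unfolding Mlt_def circ_loop_simps
  by (rule group.generate_subgroup_incl[OF group_BijGroup _ affine_maps_subgroup])
    (auto simp: left_translation_affine right_translation_eq_left)

text \<open>Left translations are affine, hence bijective.\<close>

lemma circ_division:
  assumes "a \<in> carrier G" "b \<in> carrier G"
  shows "\<exists>!x. x \<in> carrier G \<and> a \<circ>\<circ> x = b"
proof -
  have "bij_betw (left_translation (circ_loop G) a) (carrier G) (carrier G)"
    using left_translation_affine[OF assms(1)] affine_maps_Bij by (auto simp: Bij_def)
  then have "bij_betw (\<lambda>x. a \<circ>\<circ> x) (carrier G) (carrier G)"
    by (rule bij_betw_cong[THEN iffD1, rotated]) (simp add: left_translation_def)
  then show ?thesis
    using assms(2) by (fastforce simp: bij_betw_def inj_on_def image_iff)
qed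

lemma circ_loop_is_loop: "loop (circ_loop G)"
proof
  fix a b assume ab: "a \<in> carrier (circ_loop G)" "b \<in> carrier (circ_loop G)"
  show "\<exists>!x. x \<in> carrier (circ_loop G) \<and> a \<circ>\<circ> x = b"
    using circ_division ab by simp
  then show "\<exists>!x. x \<in> carrier (circ_loop G) \<and> x \<circ>\<circ> a = b"
    using ab by (metis circ_commute circ_loop_simps(1))
qed (auto simp: circ_closed circ_one circ_commute[of \<one>])

section \<open>Inner mappings are automorphisms\<close>

text \<open>This is (1 + g) (1 - f) + (1 + f) (1 - g) = 2 (1 - f g) applied to u / 2. It makes the
  translation part of an inner mapping compatible with the loop operation.\<close>

lemma mean_one_minus:
  assumes "u \<in> H" "f \<in> F" "g \<in> F"
  shows "mean g (u \<otimes> act f (inv u)) \<otimes> mean f (u \<otimes> act g (inv u)) = u \<otimes> act (f \<otimes> g) (inv u)"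
proof -
  \<comment> \<open>Working with u / 2 absorbs the halving in both means.\<close>
  define w where "w = half u"
  have w: "w \<in> H" "u = w \<otimes> w"
    unfolding w_def using assms by (simp_all add: half_mult_half)
  have half: "half (u \<otimes> act e (inv u)) = w \<otimes> act e (inv w)" if "e \<in> F" for e
    unfolding w_def using that assms by (simp add: half_mult half_act half_inv)
  have "mean g (u \<otimes> act f (inv u)) \<otimes> mean f (u \<otimes> act g (inv u))
      = w \<otimes> act f (inv w) \<otimes> act g (w \<otimes> act f (inv w))
        \<otimes> (w \<otimes> act g (inv w) \<otimes> act f (w \<otimes> act g (inv w)))"
    using assms by (simp add: mean_eq half)
  also have "\<dots> = w \<otimes> act f (inv w) \<otimes> (act g w \<otimes> act (f \<otimes> g) (inv w))
        \<otimes> (w \<otimes> act g (inv w) \<otimes> (act f w \<otimes> act (f \<otimes> g) (inv w)))"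
    using assms w by (simp add: act_mult act_act F_commute)
  \<comment> \<open>The mixed terms in f w and g w occur with both signs and are grouped to
    cancel.\<close>
  also have "\<dots> = w \<otimes> w \<otimes> (act (f \<otimes> g) (inv w) \<otimes> act (f \<otimes> g) (inv w))
        \<otimes> ((act f w \<otimes> act f (inv w)) \<otimes> (act g w \<otimes> act g (inv w)))"
    using assms w(1) by (simp add: H_ac)
  also have "\<dots> = u \<otimes> act (f \<otimes> g) (inv u)"
    using assms w by (simp flip: act_mult add: inv_mult_group)
  finally show ?thesis .
qed

lemma Inn_automorphism:
  assumes "\<theta> \<in> Inn (circ_loop G)"
  shows "\<theta> \<in> auto (circ_loop G)"
proof -
  have \<theta>: "\<theta> \<in> affine_maps" and \<theta>_one: "\<theta> \<one> = \<one>"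
    using assms Mlt_affine by (auto simp: Inn_def)
  then obtain A u v p where 1: "affine_with A u v p \<theta>"
    unfolding affine_maps_def by blast
  note D = affine_withD[OF 1]
  note AD = F_automorphismD[OF D(1)]
  \<comment> \<open>Evaluating at the neutral element and comparing H-parts and F-parts yields both
    constraints.\<close>
  have "u \<otimes> v \<otimes> p = \<one> \<otimes> \<one>"
    using \<theta>_one D(5)[of \<one> \<one>] D(2-4) by (simp add: F_automorphism_one[OF D(1)])
  then have uv: "u \<otimes> v = \<one>" and p: "p = \<one>"
    using D(2-4) by (simp_all only: decomposition_unique HF_closed)
  have "v = inv u"
    using uv D(2,3) by (metis H_commute HF_closed(1) inv_equality)
  then have eq: "\<theta> (k \<otimes> g) = A k \<otimes> (u \<otimes> act g (inv u)) \<otimes> g" if "k \<in> H" "g \<in> F" for k g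
    using that p by (simp add: D(5))
  have "\<theta> (x \<circ>\<circ> y) = \<theta> x \<circ>\<circ> \<theta> y" if xy: "x \<in> carrier G" "y \<in> carrier G" for x y
  proof -
    obtain h f k g where *: "h \<in> H" "f \<in> F" "x = h \<otimes> f" "k \<in> H" "g \<in> F" "y = k \<otimes> g"
      using xy by (elim decomposition) blast
    note cl = * D(2) AD(2)
    \<comment> \<open>Additively \<open>?c e\<close> is (1 - e) u, the translation part left after v
      = - u.\<close>
    let ?c = "\<lambda>e. u \<otimes> act e (inv u)"
    have "\<theta> x \<circ>\<circ> \<theta> y = mean g (A h \<otimes> ?c f) \<otimes> mean f (A k \<otimes> ?c g) \<otimes> (f \<otimes> g)"
      unfolding *(3,6) eq[OF *(1,2)] eq[OF *(4,5)] using cl by (intro circ_semidirect) auto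
    \<comment> \<open>Additivity of \<open>mean\<close> separates the linear contributions from the
      translation parts.\<close>
    also have "mean g (A h \<otimes> ?c f) \<otimes> mean f (A k \<otimes> ?c g)
        = mean g (A h) \<otimes> mean f (A k) \<otimes> (mean g (?c f) \<otimes> mean f (?c g))"
      using cl by (simp add: mean_mult H_ac)
    also have "mean g (?c f) \<otimes> mean f (?c g) = ?c (f \<otimes> g)"
      using cl by (intro mean_one_minus)
    also have "mean g (A h) \<otimes> mean f (A k) = A (mean g h \<otimes> mean f k)"
      using cl by (simp add: AD(3) F_automorphism_mean[OF D(1)])
    also have "A (mean g h \<otimes> mean f k) \<otimes> ?c (f \<otimes> g) \<otimes> (f \<otimes> g) = \<theta> (x \<circ>\<circ> y)"
      unfolding *(3,6) circ_semidirect[OF *(1,2,4,5)] using cl by (intro eq[symmetric]) auto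
    finally show ?thesis by simp
  qed
  moreover have "\<theta> \<in> Bij (carrier G)"
    using \<theta> by (rule affine_maps_Bij)
  ultimately show ?thesis
    by (auto simp: auto_def hom_def Bij_def bij_betw_apply)
qed

lemma circ_loop_automorphic: "automorphic_loop (circ_loop G)"
  by (intro automorphic_loop.intro automorphic_loop_axioms.intro circ_loop_is_loop Inn_automorphism)

end

theorem theorem3p3:
  fixes G :: "('a, 'm) monoid_scheme"
  assumes "split_metabelian_odd_order G"
  shows "automorphic_loop (circ_loop G)"
proof -
  interpret group G
    using assms by (simp add: split_metabelian_odd_order_def)
  obtain H F where semi: "internal_semidirect G H F"
    and H: "comm_group (G\<lparr>carrier := H\<rparr>)" "finite H" "odd (card H)"
    and F: "comm_group (G\<lparr>carrier := F\<rparr>)" "finite F" "odd (card F)"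
    using assms by (auto simp: split_metabelian_odd_order_def)
  have order: "order G = card H * card F"
    using semi by (rule order_internal_semidirect)
  with H F have "odd (order G)" by simp
  then obtain m where m: "order G = 2 * m + 1" by (rule oddE)
  interpret split_metabelian_odd G H F m
  proof
    show "x \<otimes>\<^bsub>G\<^esub> y = y \<otimes>\<^bsub>G\<^esub> x" if "x \<in> H" "y \<in> H" for x y
      using comm_groupE(4)[OF H(1)] that by simp
    show "x \<otimes>\<^bsub>G\<^esub> y = y \<otimes>\<^bsub>G\<^esub> x" if "x \<in> F" "y \<in> F" for x y
      using comm_groupE(4)[OF F(1)] that by simp
    \<comment> \<open>An infinite carrier would have \<open>order G = 0\<close>, whereas 2 m + 1 is
      positive.\<close>
    show "finite (carrier G)"
      using m by (simp add: order_gt_0_iff_finite[symmetric])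
  qed (use semi m in auto)
  show ?thesis by (rule circ_loop_automorphic)
qed

end
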